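(* Let $\ell\colon\hat{\mathcal Y}\times\mathcal Y\to\mathbb R_{\ge0}$ be a target loss with decomposition $\ell(\hat y,y)=\langle\boldsymbol\rho(y),\boldsymbol\ell^{\boldsymbol\rho}(\hat y)\rangle+c(y)$ and $\min_{\hat y\in\hat{\mathcal Y}}\ell(\hat y,y)=0$ for all $y\in\mathcal Y$. Let $\lambda>0$ and let $\Omega\colon\mathbb R^d\to\mathbb R\cup\{+\infty\}$ satisfy $\mathrm{dom}(\Omega)=\mathcal C$ and be $\lambda$-strongly convex over $\mathcal C$ with respect to the $\ell_2$-norm. Let $\Omega_\tau=\Omega+\tau$, let $L_{\Omega_\tau}$ be the corresponding convolutional Fenchel--Young loss, and for a sequence $(\boldsymbol x_t,y_t)_{t=1}^T$ let $L_t(\boldsymbol W)=L_{\Omega_\tau}(\boldsymbol W\boldsymbol x_t,y_t)$ for $\boldsymbol W\in\mathcal W$. For $t=1,\dots,T$, compute $\boldsymbol W_t\in\mathcal W$ by online gradient descent: $\boldsymbol W_1\in\mathcal W$ is arbitrary and $$\boldsymbol W_{t+1}=\arg\min\{\|\boldsymbol W_t-\eta_t\boldsymbol G_t-\boldsymbol W\|_{\mathrm F}:\boldsymbol W\in\mathcal W\},\qquad\boldsymbol G_t=\nabla L_t(\boldsymbol W_t)=\nabla L_{\Omega_\tau}(\boldsymbol\theta_t,y_t)\,\boldsymbol x_t^\top,$$ with a non-increasing sequence of learning rates $\eta_1\ge\dots\ge\eta_T$ such that, for every $t$, $$\lambda\le\eta_t\le\frac{2\left(L_t(\boldsymbol W_t)-\mathbb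 E_{\hat y_t\sim\boldsymbol\pi(\boldsymbol\theta_t)}[\ell(\hat y_t,y_t)]\right)}{\|\boldsymbol G_t\|_{\mathrm F}^2},$$ where $\boldsymbol\theta_t=\boldsymbol W_t\boldsymbol x_t$, $\boldsymbol\pi(\boldsymbol\theta_t)\in\arg\min_{\boldsymbol\pi\in\triangle^N}\Omega^*(\boldsymbol\theta_t+\mathcal L^{\boldsymbol\rho}\boldsymbol\pi)$, and the upper bound is interpreted as $+\infty$ when $\|\boldsymbol G_t\|_{\mathrm F}=0$. Then, for every $t$, the set of real numbers $\eta$ satisfying $\lambda\le\eta\le\frac{2\left(L_t(\boldsymbol W_t)-\mathbb E_{\hat y_t\sim\boldsymbol\pi(\boldsymbol\theta_t)}[\ell(\hat y_t,y_t)]\right)}{\|\boldsymbol G_t\|_{\mathrm F}^2}$ (with the upper bound read as $+\infty$ when $\|\boldsymbol G_t\|_{\mathrm F}=0$) is non-empty, and for any $\boldsymbol U_1,\dots,\boldsymbol U_T\in\mathcal W$, with $P_T=\sum_{t=2}^T\|\boldsymbol U_t-\boldsymbol U_{t-1}\|_{\mathrm F}$ and $F_T=\sum_{t=1}^TL_t(\boldsymbol U_t)$, we have $$\sum_{t=1}^T\mathbb E_{\hat y_t\sim\boldsymbol\pi(\boldsymbol\theta_t)}[\ell(\hat y_t,y_t)]\le F_T+\frac D\lambda\left(\frac D2+P_T\right).$$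
   Context: $\mathcal Y=[K]$ and $\hat{\mathcal Y}=[N]$ are finite sets of labels and predictions; $\triangle^N$ is the probability simplex over $\hat{\mathcal Y}$. In the decomposition of $\ell$, $\boldsymbol\rho\colon\mathcal Y\to\mathbb R^d$, $\boldsymbol\ell^{\boldsymbol\rho}\colon\hat{\mathcal Y}\to\mathbb R^d$ and $c\colon\mathcal Y\to\mathbb R$ are functions; $\mathcal L^{\boldsymbol\rho}\in\mathbb R^{d\times N}$ is the matrix whose column indexed by $\hat y$ is $\boldsymbol\ell^{\boldsymbol\rho}(\hat y)$; and $\mathcal C=\mathrm{conv}(\{\boldsymbol\rho(y):y\in\mathcal Y\})$. $\mathrm{dom}(\Omega)=\{\boldsymbol\mu:\Omega(\boldsymbol\mu)<+\infty\}$ and $\Omega^*(\boldsymbol\theta)=\sup_{\boldsymbol\mu\in\mathbb R^d}\{\langle\boldsymbol\theta,\boldsymbol\mu\rangle-\Omega(\boldsymbol\mu)\}$ is the convex conjugate. Define $\tau(\boldsymbol\mu)=-\min_{\hat y\in\hat{\mathcal Y}}\langle\boldsymbol\mu,\boldsymbol\ell^{\boldsymbol\rho}(\hat y)\rangle$ for $\boldsymbol\mu\in\mathbb R^d$ and $\Omega_\tau=\Omega+\tau$. The convolutional Fenchel--Young loss $L_{\Omega_\tau}\colon\mathbb R^d\times\mathcal Y\to\mathbb R_{\ge0}$ is $L_{\Omega_\tau}(\boldsymbol\theta,y)=\Omega_\tau^*(\boldsymbol\theta)+\Omega_\tau(\boldsymbol\rho(y))-\langle\boldsymbol\theta,\boldsymbol\rho(y)\rangle$.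 It is convex and (a known fact) differentiable in $\boldsymbol\theta$; $\nabla L_{\Omega_\tau}(\boldsymbol\theta,y)$ is the gradient with respect to $\boldsymbol\theta$. Inputs are vectors $\boldsymbol x_t\in\mathbb R^m$ with $\|\boldsymbol x_t\|_2\le1$ and $y_t\in\mathcal Y$; the sequence is arbitrary (possibly chosen adversarially based on past rounds). $\mathcal W\subseteq\mathbb R^{d\times m}$ is a non-empty closed convex set, and $D>0$ satisfies $\|\boldsymbol W-\boldsymbol W'\|_{\mathrm F}\le D$ for all $\boldsymbol W,\boldsymbol W'\in\mathcal W$, with $\|\cdot\|_{\mathrm F}$ the Frobenius norm. The expectation $\mathbb E_{\hat y_t\sim\boldsymbol\pi(\boldsymbol\theta_t)}$ is only over the draw of $\hat y_t$ from the distribution $\boldsymbol\pi(\boldsymbol\theta_t)$ on $\hat{\mathcal Y}$, with $\boldsymbol\theta_t$ and $y_t$ given. *)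

theory Defs
  imports "HOL-Probability.Probability"
begin

text \<open>
  Vectors are of type \<open>real ^ 'd\<close> and matrices of type \<open>real ^ 'm ^ 'd\<close> (\<open>'d\<close> rows, \<open>'m\<close> columns).
  The library norm on \<open>real ^ 'm ^ 'd\<close> is the Euclidean norm of the vector of row norms, so it is the
  Frobenius norm, and the library inner product is the Frobenius inner product.
  Labels and predictions are the elements of finite types \<open>'y\<close> and \<open>'p\<close>.
\<close>

definition prob_simplex :: "(real ^ 'p) set" where
  "prob_simplex = {q. (\<forall>i. 0 \<le> q $ i) \<and> (\<Sum>i\<in>UNIV. q $ i) = 1}"

text \<open>Meaningful for \<open>q \<in> prob_simplex\<close> only; \<open>embed_pmf\<close> turns the weights into a distribution.\<close>

definition simplex_expectation :: "real ^ 'p \<Rightarrow> ('p \<Rightarrow> real) \<Rightarrow> real" where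
  "simplex_expectation q f = measure_pmf.expectation (embed_pmf (\<lambda>i. q $ i)) f"

text \<open>Unspecified at points where \<open>f\<close> is not differentiable.\<close>

definition gradient :: "('a::real_inner \<Rightarrow> real) \<Rightarrow> 'a \<Rightarrow> 'a" where
  "gradient f x = (THE g. GDERIV f x :> g)"

definition outer_product :: "real ^ 'd \<Rightarrow> real ^ 'm \<Rightarrow> real ^ 'm ^ 'd" where
  "outer_product g x = (\<chi> i j. g $ i * x $ j)"

text \<open>Functions with values in \<open>\<real> \<union> {+\<infinity>}\<close> are \<open>ereal\<close>-valued functions that avoid \<open>-\<infinity>\<close>.\<close>

definition eff_dom :: "('a \<Rightarrow> ereal) \<Rightarrow> 'a set" where
  "eff_dom f = {x. f x < \<infinity>}"

definition strongly_convex_on :: "real \<Rightarrow> 'a::real_normed_vector set \<Rightarrow> ('a \<Rightarrow> ereal) \<Rightarrow> bool" where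
  "strongly_convex_on lam C f \<longleftrightarrow> convex C \<and>
     (\<forall>x\<in>C. \<forall>y\<in>C. \<forall>u\<in>{0..1}.
        f (u *\<^sub>R x + (1 - u) *\<^sub>R y)
          \<le> ereal u * f x + ereal (1 - u) * f y
             - ereal (lam / 2 * u * (1 - u) * (norm (x - y))\<^sup>2))"

definition conjugate :: "('a::real_inner \<Rightarrow> ereal) \<Rightarrow> 'a \<Rightarrow> ereal" where
  "conjugate f \<theta> = (SUP \<mu>. ereal (\<theta> \<bullet> \<mu>) - f \<mu>)"

definition loss_matrix :: "('p \<Rightarrow> real ^ 'd) \<Rightarrow> real ^ 'p ^ 'd" where
  "loss_matrix ell = (\<chi> i j. ell j $ i)"

definition tau :: "('p::finite \<Rightarrow> 'a::real_inner) \<Rightarrow> 'a \<Rightarrow> real" where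
  "tau ell \<mu> = - (MIN j. \<mu> \<bullet> ell j)"

definition Omega_tau ::
    "('p::finite \<Rightarrow> 'a::real_inner) \<Rightarrow> ('a \<Rightarrow> ereal) \<Rightarrow> 'a \<Rightarrow> ereal" where
  "Omega_tau ell \<Omega> \<mu> = \<Omega> \<mu> + ereal (tau ell \<mu>)"

text \<open>
  The extended-real expression is finite whenever \<open>\<Omega>\<close> is convex with effective domain
  \<open>convex hull (range \<rho>)\<close>, so \<open>real_of_ereal\<close> loses nothing there.
\<close>

definition conv_fy_loss ::
    "('p::finite \<Rightarrow> 'a::real_inner) \<Rightarrow> ('a \<Rightarrow> ereal) \<Rightarrow> ('y \<Rightarrow> 'a) \<Rightarrow> 'a \<Rightarrow> 'y \<Rightarrow> real" where
  "conv_fy_loss ell \<Omega> \<rho> \<theta> y =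
     real_of_ereal (conjugate (Omega_tau ell \<Omega>) \<theta> + Omega_tau ell \<Omega> (\<rho> y) - ereal (\<theta> \<bullet> \<rho> y))"

end

theory Submission
  imports Defs
begin

text \<open>
  Put \<open>\<nu> = \<theta> + \<L> \<pi>\<close> for a minimiser \<open>\<pi>\<close>. Infimal convolution gives \<open>\<Omega>\<^sub>\<tau>\<^sup>*(\<theta>) = \<Omega>\<^sup>*(\<nu>)\<close> with a
  common gradient \<open>m\<close>, and \<open>\<tau>(\<rho>(y)) = c(y)\<close>, so the surrogate excess \<open>L(\<theta>, y) - E[\<ell>]\<close> equals
  \<open>\<Omega>\<^sup>*(\<nu>) + \<Omega>(\<rho>(y)) - \<langle>\<nu>, \<rho>(y)\<rangle>\<close>. Strong convexity bounds this from below by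
  \<open>\<lambda>/2 \<parallel>\<rho>(y) - m\<parallel>\<^sup>2\<close>, where \<open>m - \<rho>(y)\<close> is the gradient of the loss. Hence a step size \<open>\<lambda>\<close> is always
  admissible, and for admissible step sizes the excess absorbs the term \<open>\<eta>/2 \<parallel>G\<parallel>\<^sup>2\<close> in the regret
  analysis of online gradient descent, leaving only the telescoping distances and the drift of \<open>U\<close>.
\<close>


section \<open>Extended-real conjugates and lower bounds for convex functions on polytopes\<close>

lemma conjugate_le_iff:
  assumes "\<And>\<mu>. \<Omega> \<mu> \<noteq> -\<infinity>"
  shows "conjugate \<Omega> \<theta> \<le> ereal A \<longleftrightarrow> (\<forall>\<mu>\<in>eff_dom \<Omega>. \<theta> \<bullet> \<mu> - real_of_ereal (\<Omega> \<mu>) \<le> A)"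
proof -
  have "ereal (\<theta> \<bullet> \<mu>) - \<Omega> \<mu> \<le> ereal A \<longleftrightarrow>
      (\<mu> \<in> eff_dom \<Omega> \<longrightarrow> \<theta> \<bullet> \<mu> - real_of_ereal (\<Omega> \<mu>) \<le> A)" for \<mu>
    using assms[of \<mu>] by (cases "\<Omega> \<mu>") (auto simp: eff_dom_def)
  then show ?thesis
    by (auto simp: conjugate_def SUP_le_iff)
qed

text \<open>One point of the domain keeps the supremum above minus infinity, and \<open>A\<close>
  keeps it below plus infinity; from here on conjugates can be handled as real numbers.\<close>

lemma conjugate_finite:
  assumes proper: "\<And>\<mu>. \<Omega> \<mu> \<noteq> -\<infinity>" and "eff_dom \<Omega> \<noteq> {}"
    and "\<And>\<mu>. \<mu> \<in> eff_dom \<Omega> \<Longrightarrow> \<theta> \<bullet> \<mu> - real_of_ereal (\<Omega> \<mu>) \<le> A"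
  shows "ereal (real_of_ereal (conjugate \<Omega> \<theta>)) = conjugate \<Omega> \<theta>"
proof -
  obtain \<mu> where \<mu>: "\<mu> \<in> eff_dom \<Omega>"
    using assms(2) by blast
  have "ereal (\<theta> \<bullet> \<mu>) - \<Omega> \<mu> \<le> conjugate \<Omega> \<theta>"
    unfolding conjugate_def by (rule SUP_upper) simp
  moreover have "ereal (\<theta> \<bullet> \<mu>) - \<Omega> \<mu> \<noteq> -\<infinity>"
    using \<mu> proper[of \<mu>] by (cases "\<Omega> \<mu>") (auto simp: eff_dom_def)
  ultimately have "conjugate \<Omega> \<theta> \<noteq> -\<infinity>"
    by auto
  moreover have "conjugate \<Omega> \<theta> \<le> ereal A"
    using assms(3) by (simp add: conjugate_le_iff[OF proper])
  ultimately show ?thesis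
    by (cases "conjugate \<Omega> \<theta>") auto
qed

text \<open>The barycentre is a convex combination, with weight independent of \<open>x\<close>, of any given point
  \<open>x\<close> of the polytope and another one; so a small \<open>f x\<close> would make \<open>f\<close> small at the barycentre.\<close>

lemma convex_on_hull_bdd_below:
  fixes f :: "'a::real_vector \<Rightarrow> real"
  assumes "finite S" "S \<noteq> {}" and f: "convex_on (convex hull S) f"
  obtains B where "\<And>x. x \<in> convex hull S \<Longrightarrow> B \<le> f x"
proof -
  define n where "n = real (card S)"
  have n: "n > 0"
    using assms by (simp add: n_def card_gt_0_iff)
  define z where "z = (1 / n) *\<^sub>R (\<Sum>s\<in>S. s)"
  define M where "M = Max (f ` S)"
  have M: "f x \<le> M" if "x \<in> convex hull S" for x
  proof -
    have "\<forall>s\<in>S. f s \<le> M"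
      using \<open>finite S\<close> by (auto simp: M_def)
    then show ?thesis
      using convex_on_convex_hull_bound[OF f] that by blast
  qed
  \<comment> \<open>The bound is \<open>f z \<le> (f x + n * M) / (n + 1)\<close> solved for
    \<open>f x\<close>.\<close>
  have "(n + 1) * f z - n * M \<le> f x" if x: "x \<in> convex hull S" for x
  proof -
    obtain a where a: "\<And>s. s \<in> S \<Longrightarrow> 0 \<le> a s" "sum a S = 1" "(\<Sum>s\<in>S. a s *\<^sub>R s) = x"
      using x unfolding convex_hull_finite[OF \<open>finite S\<close>] by auto
    \<comment> \<open>Solves \<open>1 / n = a s / (n + 1) + n / (n + 1) * b s\<close>, the balance
      of the weights at \<open>s\<close>. Giving \<open>x\<close> the weight
      \<open>1 / (n + 1)\<close> instead of \<open>1 / n\<close> leaves a positive weight for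
      \<open>x'\<close> even if \<open>S\<close> is a singleton.\<close>
    define b where "b s = (1 / n - a s / (n + 1)) * ((n + 1) / n)" for s
    have a1: "a s \<le> 1" if "s \<in> S" for s
      using a \<open>finite S\<close> that member_le_sum[of s S a] by auto
    have b0: "0 \<le> b s" if "s \<in> S" for s
    proof -
      have "a s / (n + 1) \<le> 1 / n"
        using a1[OF that] a(1)[OF that] n by (intro frac_le) auto
      then show ?thesis
        using n by (simp add: b_def)
    qed
    have b1: "sum b S = 1"
    proof -
      have "sum b S = (n * (1 / n) - sum a S / (n + 1)) * ((n + 1) / n)"
        by (simp add: b_def n_def sum_subtractf flip: sum_distrib_right sum_divide_distrib)
      also have "n * (1 / n) - sum a S / (n + 1) = n / (n + 1)"
        using n a(2) by (simp add: divide_simps)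
      also have "n / (n + 1) * ((n + 1) / n) = 1"
        using n by simp
      finally show ?thesis .
    qed
    define x' where "x' = (\<Sum>s\<in>S. b s *\<^sub>R s)"
    have x': "x' \<in> convex hull S"
      unfolding convex_hull_finite[OF \<open>finite S\<close>] x'_def using b0 b1 by auto
    have "(1 / (n + 1)) *\<^sub>R x + (n / (n + 1)) *\<^sub>R x'
        = (\<Sum>s\<in>S. (a s / (n + 1) + n / (n + 1) * b s) *\<^sub>R s)"
      by (simp add: x'_def scaleR_sum_right sum.distrib scaleR_add_left flip: a(3))
    also have "\<dots> = (\<Sum>s\<in>S. (1 / n) *\<^sub>R s)"
    proof (rule sum.cong)
      fix s
      have "n / (n + 1) * b s = 1 / n - a s / (n + 1)"
        using n by (simp add: b_def)
      then show "(a s / (n + 1) + n / (n + 1) * b s) *\<^sub>R s = (1 / n) *\<^sub>R s"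
        by simp
    qed simp
    finally have z: "z = (1 / (n + 1)) *\<^sub>R x + (n / (n + 1)) *\<^sub>R x'"
      by (simp add: z_def scaleR_sum_right)
    have "1 / (n + 1) + n / (n + 1) = 1"
      using n by (simp add: field_simps)
    then have "f z \<le> 1 / (n + 1) * f x + n / (n + 1) * f x'"
      unfolding z using n
      by (intro f[unfolded convex_on_def, THEN conjunct2, rule_format] x x') auto
    also have "\<dots> \<le> 1 / (n + 1) * f x + n / (n + 1) * M"
      using M[OF x'] n by (intro add_left_mono mult_left_mono) auto
    also have "\<dots> = (f x + n * M) / (n + 1)"
      by (simp add: add_divide_distrib)
    finally show ?thesis
      using n by (simp add: field_simps)
  qed
  then show ?thesis
    by (rule that)
qed

section \<open>Strongly convex functions on a polytope and smoothness of their conjugates\<close>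

locale strongly_convex_polytope =
  fixes \<Omega> :: "'a::euclidean_space \<Rightarrow> ereal" and S :: "'a set" and lam :: real
  assumes proper: "\<Omega> \<mu> \<noteq> -\<infinity>"
    and fin: "finite S" and ne: "S \<noteq> {}"
    and dom: "eff_dom \<Omega> = convex hull S"
    and lam: "lam > 0"
    and sc: "strongly_convex_on lam (convex hull S) \<Omega>"
begin

text \<open>Outside the hull the conversion turns plus infinity into 0, so statements about
  \<open>f\<close> are restricted to the hull.\<close>

definition f :: "'a \<Rightarrow> real" where "f \<mu> = real_of_ereal (\<Omega> \<mu>)"

definition conj_f :: "'a \<Rightarrow> real" where "conj_f \<theta> = real_of_ereal (conjugate \<Omega> \<theta>)"

lemma \<Omega>_eq: "\<mu> \<in> convex hull S \<Longrightarrow> \<Omega> \<mu> = ereal (f \<mu>)"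
  using dom proper[of \<mu>] by (cases "\<Omega> \<mu>") (auto simp: eff_dom_def f_def)

lemma f_strongly_convex:
  assumes "x \<in> convex hull S" "y \<in> convex hull S" "0 \<le> u" "u \<le> 1"
  shows "f (u *\<^sub>R x + (1 - u) *\<^sub>R y)
    \<le> u * f x + (1 - u) * f y - lam / 2 * u * (1 - u) * (norm (x - y))\<^sup>2"
proof -
  have "u *\<^sub>R x + (1 - u) *\<^sub>R y \<in> convex hull S"
    using assms by (intro convexD) auto
  moreover have "\<Omega> (u *\<^sub>R x + (1 - u) *\<^sub>R y) \<le> ereal u * \<Omega> x + ereal (1 - u) * \<Omega> y
      - ereal (lam / 2 * u * (1 - u) * (norm (x - y))\<^sup>2)"
    using sc assms unfolding strongly_convex_on_def by auto
  ultimately show ?thesis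
    using assms by (simp add: \<Omega>_eq)
qed

lemma convex_f: "convex_on (convex hull S) f"
proof (rule convex_onI)
  fix t :: real and x y
  assume t: "0 < t" "t < 1" and xy: "x \<in> convex hull S" "y \<in> convex hull S"
  have "0 \<le> lam / 2 * (1 - t) * (1 - (1 - t)) * (norm (x - y))\<^sup>2"
    using t lam by simp
  then show "f ((1 - t) *\<^sub>R x + t *\<^sub>R y) \<le> (1 - t) * f x + t * f y"
    using f_strongly_convex[OF xy, of "1 - t"] t by auto
qed simp

text \<open>The polytope is bounded, which controls the linear term, and \<open>f\<close> is bounded
  below on it; this is the source of finiteness of the conjugate.\<close>

lemma bdd_above_conj:
  obtains A where "\<And>\<mu>. \<mu> \<in> convex hull S \<Longrightarrow> \<theta> \<bullet> \<mu> - f \<mu> \<le> A"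
proof -
  obtain B where B: "\<And>x. x \<in> convex hull S \<Longrightarrow> B \<le> f x"
    using convex_on_hull_bdd_below[OF fin ne convex_f] by blast
  have "bounded (convex hull S)"
    using fin by (simp add: finite_imp_bounded_convex_hull)
  then obtain R where R: "\<And>x. x \<in> convex hull S \<Longrightarrow> norm x \<le> R"
    unfolding bounded_iff by blast
  show ?thesis
  proof (rule that)
    fix \<mu> assume \<mu>: "\<mu> \<in> convex hull S"
    have "\<theta> \<bullet> \<mu> \<le> norm \<theta> * R"
      using norm_cauchy_schwarz[of \<theta> \<mu>] mult_left_mono[OF R[OF \<mu>], of "norm \<theta>"] by auto
    then show "\<theta> \<bullet> \<mu> - f \<mu> \<le> norm \<theta> * R - B"
      using B[OF \<mu>] by auto
  qed
qed

lemma conjugate_eq: "conjugate \<Omega> \<theta> = ereal (conj_f \<theta>)"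
proof -
  obtain A where "\<And>\<mu>. \<mu> \<in> convex hull S \<Longrightarrow> \<theta> \<bullet> \<mu> - f \<mu> \<le> A"
    using bdd_above_conj by blast
  then show ?thesis
    using conjugate_finite[where \<Omega>=\<Omega>, OF proper, where \<theta>=\<theta> and A=A] ne
    by (simp add: conj_f_def dom f_def)
qed

lemma conj_f_le_iff: "conj_f \<theta> \<le> A \<longleftrightarrow> (\<forall>\<mu>\<in>convex hull S. \<theta> \<bullet> \<mu> - f \<mu> \<le> A)"
  using conjugate_le_iff[where \<Omega>=\<Omega>, OF proper, where \<theta>=\<theta> and A=A]
    by (simp add: conjugate_eq dom f_def)

lemma conj_f_upper: "\<mu> \<in> convex hull S \<Longrightarrow> \<theta> \<bullet> \<mu> - f \<mu> \<le> conj_f \<theta>"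
  using conj_f_le_iff by blast

text \<open>As \<open>\<Omega>\<close> need not be lower semicontinuous, the supremum defining the conjugate may not be
  attained; the limit \<open>m\<close> of a maximising sequence plays the role of the maximiser.\<close>

lemma maximising_sequence:
  obtains X m where "\<And>n. X n \<in> convex hull S" and "X \<longlonglongrightarrow> m"
    and "(\<lambda>n. \<theta> \<bullet> X n - f (X n)) \<longlonglongrightarrow> conj_f \<theta>"
    and "\<And>\<mu>. \<mu> \<in> convex hull S \<Longrightarrow> \<theta> \<bullet> \<mu> - f \<mu> \<le> conj_f \<theta> - lam / 2 * (norm (\<mu> - m))\<^sup>2"
proof -
  let ?C = "convex hull S"
  have "\<exists>\<mu>\<in>?C. conj_f \<theta> - inverse (real (Suc n)) < \<theta> \<bullet> \<mu> - f \<mu>" for n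
    using conj_f_le_iff[of \<theta> "conj_f \<theta> - inverse (real (Suc n))"]
    by (auto simp: not_le)
  then obtain Z where Z: "\<And>n. Z n \<in> ?C"
      "\<And>n. conj_f \<theta> - inverse (real (Suc n)) < \<theta> \<bullet> Z n - f (Z n)"
    by metis
  \<comment> \<open>Compactness makes a subsequence of points converge; the objective values along
    it converge because those of the whole sequence do.\<close>
  have "compact ?C"
    using fin by (simp add: finite_imp_compact_convex_hull)
  then obtain m r where r: "strict_mono r" "(Z \<circ> r) \<longlonglongrightarrow> m"
    using Z(1) unfolding compact_def by metis
  define X where "X = Z \<circ> r"
  have X: "X n \<in> ?C" for n
    using Z(1) by (simp add: X_def)
  have Xm: "X \<longlonglongrightarrow> m"
    using r(2) by (simp only: X_def)
  have lim: "(\<lambda>n. \<theta> \<bullet> X n - f (X n)) \<longlonglongrightarrow> conj_f \<theta>"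
  proof -
    have "(\<lambda>n. \<theta> \<bullet> Z n - f (Z n)) \<longlonglongrightarrow> conj_f \<theta>"
    proof (rule tendsto_sandwich)
      show "\<forall>\<^sub>F n in sequentially. conj_f \<theta> - inverse (real (Suc n)) \<le> \<theta> \<bullet> Z n - f (Z n)"
        by (intro always_eventually allI less_imp_le Z(2))
      show "\<forall>\<^sub>F n in sequentially. \<theta> \<bullet> Z n - f (Z n) \<le> conj_f \<theta>"
        using conj_f_upper Z(1) by auto
      show "(\<lambda>n. conj_f \<theta> - inverse (real (Suc n))) \<longlonglongrightarrow> conj_f \<theta>"
        using tendsto_diff[OF tendsto_const LIMSEQ_inverse_real_of_nat, of "conj_f \<theta>"] by simp
    qed simp
    from LIMSEQ_subseq_LIMSEQ[OF this r(1)] show ?thesis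
      by (simp add: X_def o_def)
  qed
  have "\<theta> \<bullet> \<mu> - f \<mu> \<le> conj_f \<theta> - lam / 2 * (norm (\<mu> - m))\<^sup>2" if \<mu>: "\<mu> \<in> ?C" for \<mu>
  proof -
    \<comment> \<open>The objective at a point between \<open>\<mu>\<close> and \<open>X n\<close>
      is at most \<open>conj_f \<theta>\<close> but gains a quadratic term from strong convexity. As
      \<open>n\<close> grows, the share \<open>(1 - u) * conj_f \<theta>\<close> cancels and a
      factor \<open>u\<close> can be divided out.\<close>
    have *: "(\<theta> \<bullet> \<mu> - f \<mu>) + lam / 2 * (1 - u) * (norm (\<mu> - m))\<^sup>2 \<le> conj_f \<theta>"
      if u: "0 < u" "u < 1" for u
    proof -
      have "u * (\<theta> \<bullet> \<mu> - f \<mu>) + (1 - u) * (\<theta> \<bullet> X n - f (X n))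
          + lam / 2 * u * (1 - u) * (norm (\<mu> - X n))\<^sup>2 \<le> conj_f \<theta>" for n
      proof -
        have "u *\<^sub>R \<mu> + (1 - u) *\<^sub>R X n \<in> ?C"
          using \<mu> X u by (intro convexD) auto
        from conj_f_upper[OF this, of \<theta>] f_strongly_convex[OF \<mu> X[of n], of u] u
        show ?thesis
          by (simp add: inner_add_right algebra_simps)
      qed
      moreover have "(\<lambda>n. u * (\<theta> \<bullet> \<mu> - f \<mu>) + (1 - u) * (\<theta> \<bullet> X n - f (X n))
          + lam / 2 * u * (1 - u) * (norm (\<mu> - X n))\<^sup>2) \<longlonglongrightarrow>
          u * (\<theta> \<bullet> \<mu> - f \<mu>) + (1 - u) * conj_f \<theta> + lam / 2 * u * (1 - u) * (norm (\<mu> - m))\<^sup>2"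
        by (intro tendsto_intros lim Xm)
      ultimately have "u * (\<theta> \<bullet> \<mu> - f \<mu>) + (1 - u) * conj_f \<theta>
          + lam / 2 * u * (1 - u) * (norm (\<mu> - m))\<^sup>2 \<le> conj_f \<theta>"
        by (intro LIMSEQ_le_const2) auto
      then have "u * ((\<theta> \<bullet> \<mu> - f \<mu>) + lam / 2 * (1 - u) * (norm (\<mu> - m))\<^sup>2) \<le> u * conj_f \<theta>"
        by (simp add: algebra_simps)
      then show ?thesis
        using u by simp
    qed
    \<comment> \<open>Letting \<open>u\<close> tend to 0 recovers the full constant
      \<open>lam / 2\<close>.\<close>
    have "((\<lambda>u. (\<theta> \<bullet> \<mu> - f \<mu>) + lam / 2 * (1 - u) * (norm (\<mu> - m))\<^sup>2) \<longlongrightarrow>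
        (\<theta> \<bullet> \<mu> - f \<mu>) + lam / 2 * (1 - 0) * (norm (\<mu> - m))\<^sup>2) (at_right 0)"
      by (intro tendsto_intros)
    moreover have "\<forall>\<^sub>F u in at_right 0.
        (\<theta> \<bullet> \<mu> - f \<mu>) + lam / 2 * (1 - u) * (norm (\<mu> - m))\<^sup>2 \<le> conj_f \<theta>"
      using eventually_at_right[of 0 "1::real"] * by (auto intro!: exI[of _ 1])
    ultimately have "(\<theta> \<bullet> \<mu> - f \<mu>) + lam / 2 * (1 - 0) * (norm (\<mu> - m))\<^sup>2 \<le> conj_f \<theta>"
      by (intro tendsto_upperbound) auto
    then show ?thesis
      by simp
  qed
  then show ?thesis
    using that[OF X Xm lim] by blast
qed

text \<open>Dual form of quadratic growth: Young's inequality trades the term \<open>lam / 2\<close>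
  times a squared distance in \<open>\<mu>\<close> for a squared distance in \<open>\<theta>\<close>
  over \<open>2 * lam\<close>. Here \<open>m\<close> acts as the gradient of \<open>conj_f\<close>
  at \<open>\<theta>\<close>.\<close>

lemma conj_f_upper_quadratic:
  assumes "\<And>\<mu>. \<mu> \<in> convex hull S \<Longrightarrow> \<theta> \<bullet> \<mu> - f \<mu> \<le> conj_f \<theta> - lam / 2 * (norm (\<mu> - m))\<^sup>2"
  shows "conj_f \<theta>' \<le> conj_f \<theta> + (\<theta>' - \<theta>) \<bullet> m + (norm (\<theta>' - \<theta>))\<^sup>2 / (2 * lam)"
  unfolding conj_f_le_iff
proof
  fix \<mu> assume \<mu>: "\<mu> \<in> convex hull S"
  let ?a = "norm (\<theta>' - \<theta>)" and ?b = "norm (\<mu> - m)"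
  have "0 \<le> (?a - lam * ?b)\<^sup>2 / (2 * lam)"
    using lam by simp
  also have "\<dots> = ?a\<^sup>2 / (2 * lam) - ?a * ?b + lam / 2 * ?b\<^sup>2"
    using lam by (simp add: power2_eq_square field_simps)
  finally have "?a * ?b \<le> ?a\<^sup>2 / (2 * lam) + lam / 2 * ?b\<^sup>2"
    by simp
  moreover have "(\<theta>' - \<theta>) \<bullet> (\<mu> - m) \<le> ?a * ?b"
    by (rule norm_cauchy_schwarz)
  ultimately show "\<theta>' \<bullet> \<mu> - f \<mu> \<le> conj_f \<theta> + (\<theta>' - \<theta>) \<bullet> m + ?a\<^sup>2 / (2 * lam)"
    using assms[OF \<mu>] by (simp add: inner_diff_left inner_diff_right)
qed


text \<open>By the quadratic upper bound, a step \<open>s\<close> along \<open>v\<close> changes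
  \<open>conj_f\<close> by at most \<open>s * (v \<bullet> m)\<close> plus a term of order
  \<open>s\<close> squared; divide by \<open>s\<close> and let it tend to 0.\<close>

lemma first_order_optimality:
  assumes m: "\<And>\<mu>. \<mu> \<in> convex hull S \<Longrightarrow>
      \<nu> \<bullet> \<mu> - f \<mu> \<le> conj_f \<nu> - lam / 2 * (norm (\<mu> - m))\<^sup>2"
    and min: "\<And>s. 0 < s \<Longrightarrow> s < 1 \<Longrightarrow> conj_f \<nu> \<le> conj_f (\<nu> + s *\<^sub>R v)"
  shows "0 \<le> v \<bullet> m"
proof -
  have "0 \<le> v \<bullet> m + s * ((norm v)\<^sup>2 / (2 * lam))" if s: "0 < s" "s < 1" for s
  proof -
    have "0 \<le> s * (v \<bullet> m) + (norm (s *\<^sub>R v))\<^sup>2 / (2 * lam)"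
      using min[OF s] conj_f_upper_quadratic[OF m, where \<theta>'="\<nu> + s *\<^sub>R v"] by simp
    also have "\<dots> = s * (v \<bullet> m + s * ((norm v)\<^sup>2 / (2 * lam)))"
      by (simp add: power2_eq_square algebra_simps)
    finally show ?thesis
      using s by (simp add: zero_le_mult_iff)
  qed
  then have "\<forall>\<^sub>F s in at_right 0. 0 \<le> v \<bullet> m + s * ((norm v)\<^sup>2 / (2 * lam))"
    using eventually_at_right[of 0 "1::real"] by (auto intro!: exI[of _ 1])
  moreover have "((\<lambda>s. v \<bullet> m + s * ((norm v)\<^sup>2 / (2 * lam))) \<longlongrightarrow>
      v \<bullet> m + 0 * ((norm v)\<^sup>2 / (2 * lam))) (at_right 0)"
    by (intro tendsto_intros)
  ultimately have "0 \<le> v \<bullet> m + 0 * ((norm v)\<^sup>2 / (2 * lam))"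
    by (intro tendsto_lowerbound) auto
  then show ?thesis
    by simp
qed

end

section \<open>The function \<open>tau\<close> and mixtures over the simplex\<close>

lemma tau_ge: "- (\<mu> \<bullet> ell j) \<le> tau ell \<mu>" for ell :: "'p::finite \<Rightarrow> 'a::real_inner"
  by (simp add: tau_def)

lemma tau_le_iff: "tau ell \<mu> \<le> c \<longleftrightarrow> (\<forall>j. - c \<le> \<mu> \<bullet> ell j)"
  for ell :: "'p::finite \<Rightarrow> 'a::real_inner"
proof -
  have "- c \<le> (MIN j. \<mu> \<bullet> ell j) \<longleftrightarrow> (\<forall>j. - c \<le> \<mu> \<bullet> ell j)"
    by (subst Min_ge_iff) auto
  then show ?thesis
    by (simp only: tau_def minus_le_iff)
qed

text \<open>The sum of norms is a crude Lipschitz constant; it suffices for passing to the limit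
  along a maximising sequence.\<close>

lemma tau_le_lipschitz:
  fixes ell :: "'p::finite \<Rightarrow> 'a::real_inner"
  shows "tau ell \<mu> \<le> tau ell m + (\<Sum>j\<in>UNIV. norm (ell j)) * norm (\<mu> - m)"
  unfolding tau_le_iff
proof
  fix j
  have "(m - \<mu>) \<bullet> ell j \<le> norm (\<mu> - m) * norm (ell j)"
    using norm_cauchy_schwarz[of "m - \<mu>" "ell j"] by (simp add: norm_minus_commute)
  also have "\<dots> \<le> norm (\<mu> - m) * (\<Sum>j\<in>UNIV. norm (ell j))"
    by (intro mult_left_mono member_le_sum) auto
  finally show "- (tau ell m + (\<Sum>j\<in>UNIV. norm (ell j)) * norm (\<mu> - m)) \<le> \<mu> \<bullet> ell j"
    using tau_ge[of m ell j] by (simp add: inner_diff_left mult.commute)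
qed

text \<open>A minimum is at most any average. This is the weak-duality half of the infimal
  convolution formula.\<close>

lemma neg_tau_le_mix:
  assumes "q \<in> prob_simplex"
  shows "- tau ell \<mu> \<le> (\<Sum>j\<in>UNIV. (q $ j) *\<^sub>R ell j) \<bullet> \<mu>"
proof -
  have "- tau ell \<mu> = (\<Sum>j\<in>UNIV. q $ j * - tau ell \<mu>)"
    using assms by (simp only: sum_distrib_right [symmetric]) (simp add: prob_simplex_def)
  also have "\<dots> \<le> (\<Sum>j\<in>UNIV. q $ j * (ell j \<bullet> \<mu>))"
    using assms tau_ge[of \<mu> ell]
    by (intro sum_mono mult_left_mono) (auto simp: prob_simplex_def minus_le_iff inner_commute)
  finally show ?thesis
    by (simp add: inner_sum_left)
qed

lemma axis_in_prob_simplex: "axis j 1 \<in> prob_simplex"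
  by (simp add: prob_simplex_def axis_def)

lemma convex_prob_simplex: "convex prob_simplex"
  unfolding convex_def prob_simplex_def
  by (auto simp: sum.distrib simp flip: sum_distrib_left)

lemma loss_matrix_mult: "loss_matrix ell *v q = (\<Sum>j\<in>UNIV. (q $ j) *\<^sub>R ell j)"
  by (simp add: vec_eq_iff loss_matrix_def matrix_vector_mult_def mult.commute)

lemma simplex_expectation_eq:
  fixes q :: "real ^ 'p::finite"
  assumes "q \<in> prob_simplex"
  shows "simplex_expectation q h = (\<Sum>i\<in>UNIV. q $ i * h i)"
proof -
  have nonneg: "0 \<le> q $ i" for i
    using assms by (simp add: prob_simplex_def)
  have "(\<integral>\<^sup>+ i. ennreal (q $ i) \<partial>count_space UNIV) = ennreal (\<Sum>i\<in>UNIV. q $ i)"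
    by (simp add: nn_integral_count_space_finite nonneg)
  then have "pmf (embed_pmf (\<lambda>i. q $ i)) i = q $ i" for i
    using assms nonneg by (intro pmf_embed_pmf) (auto simp: prob_simplex_def)
  then show ?thesis
    by (simp add: simplex_expectation_def integral_measure_pmf[of UNIV])
qed

section \<open>Infimal convolution: the conjugate of \<open>Omega_tau\<close>\<close>

context strongly_convex_polytope
begin

text \<open>At a minimiser \<open>q\<close> of \<open>\<Omega>\<^sup>*(\<theta> + \<L> q)\<close> the infimal convolution formula
  \<open>\<Omega>\<^sub>\<tau>\<^sup>*(\<theta>) = \<Omega>\<^sup>*(\<theta> + \<L> q)\<close> holds, and both sides have the same gradient \<open>m\<close>. The proof bypasses
  a minimax theorem: first-order optimality of \<open>q\<close> says exactly that \<open>\<langle>m, \<L> q\<rangle> = -\<tau>(m)\<close>.\<close>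

lemma infimal_convolution:
  fixes ell :: "'p::finite \<Rightarrow> 'a" and \<theta> :: 'a and q :: "real ^ 'p"
  defines "mix \<equiv> \<lambda>q :: real ^ 'p. \<Sum>j\<in>UNIV. (q $ j) *\<^sub>R ell j"
    and "g \<equiv> \<lambda>\<theta>. real_of_ereal (conjugate (Omega_tau ell \<Omega>) \<theta>)"
  assumes q: "q \<in> prob_simplex"
    and opt: "\<And>q'. q' \<in> prob_simplex \<Longrightarrow> conj_f (\<theta> + mix q) \<le> conj_f (\<theta> + mix q')"
  obtains m where "g \<theta> = conj_f (\<theta> + mix q)"
    and "\<And>\<theta>'. conjugate (Omega_tau ell \<Omega>) \<theta>' = ereal (g \<theta>')"
    and "\<And>\<theta>'. g \<theta> + (\<theta>' - \<theta>) \<bullet> m \<le> g \<theta>'"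
    and "\<And>\<theta>'. g \<theta>' \<le> g \<theta> + (\<theta>' - \<theta>) \<bullet> m + (norm (\<theta>' - \<theta>))\<^sup>2 / (2 * lam)"
    and "\<And>\<mu>. \<mu> \<in> convex hull S \<Longrightarrow> lam / 2 * (norm (\<mu> - m))\<^sup>2
      \<le> conj_f (\<theta> + mix q) + f \<mu> - (\<theta> + mix q) \<bullet> \<mu>"
proof -
  let ?C = "convex hull S" and ?\<nu> = "\<theta> + mix q" and ?\<Omega>\<tau> = "Omega_tau ell \<Omega>"
  have proper': "?\<Omega>\<tau> \<mu> \<noteq> -\<infinity>" for \<mu>
    using proper[of \<mu>] by (cases "\<Omega> \<mu>") (auto simp: Omega_tau_def)
  have dom': "eff_dom ?\<Omega>\<tau> = ?C"
    by (auto simp: eff_dom_def Omega_tau_def simp flip: dom)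
  have f': "real_of_ereal (?\<Omega>\<tau> \<mu>) = f \<mu> + tau ell \<mu>" if "\<mu> \<in> ?C" for \<mu>
    using that by (simp add: Omega_tau_def \<Omega>_eq)
  \<comment> \<open>The mixture \<open>q\<close> stays fixed while \<open>\<theta>'\<close> varies,
    so that \<open>g\<close> later inherits the quadratic upper bound of
    \<open>conj_f\<close>.\<close>
  have upper: "\<theta>' \<bullet> \<mu> - real_of_ereal (?\<Omega>\<tau> \<mu>) \<le> conj_f (\<theta>' + mix q)" if "\<mu> \<in> ?C" for \<theta>' \<mu>
    using conj_f_upper[OF that, of "\<theta>' + mix q"] neg_tau_le_mix[OF q, of ell \<mu>]
    by (simp add: f' that mix_def inner_add_left)
  have g: "conjugate ?\<Omega>\<tau> \<theta>' = ereal (g \<theta>')" for \<theta>'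
    using conjugate_finite[where \<Omega>="?\<Omega>\<tau>", OF proper' _ upper] ne by (simp add: g_def dom')
  have g_le_iff: "g \<theta>' \<le> A \<longleftrightarrow> (\<forall>\<mu>\<in>?C. \<theta>' \<bullet> \<mu> - real_of_ereal (?\<Omega>\<tau> \<mu>) \<le> A)" for \<theta>' A
    using conjugate_le_iff[where \<Omega>="?\<Omega>\<tau>", OF proper', where \<theta>=\<theta>' and A=A]
    by (simp add: g dom')
  have g_upper: "g \<theta>' \<le> conj_f (\<theta>' + mix q)" for \<theta>'
    using upper by (simp add: g_le_iff)
  obtain X m where X: "\<And>n. X n \<in> ?C" "X \<longlonglongrightarrow> m"
      "(\<lambda>n. ?\<nu> \<bullet> X n - f (X n)) \<longlonglongrightarrow> conj_f ?\<nu>"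
    and growth: "\<And>\<mu>. \<mu> \<in> ?C \<Longrightarrow> ?\<nu> \<bullet> \<mu> - f \<mu> \<le> conj_f ?\<nu> - lam / 2 * (norm (\<mu> - m))\<^sup>2"
    using maximising_sequence[of ?\<nu>] by blast
  have tau_m: "tau ell m \<le> - (mix q \<bullet> m)"
    unfolding tau_le_iff
  proof
    fix j
    have "0 \<le> (ell j - mix q) \<bullet> m"
    proof (rule first_order_optimality[OF growth])
      fix s :: real
      assume s: "0 < s" "s < 1"
      \<comment> \<open>Moving \<open>q\<close> towards the vertex \<open>j\<close> of the simplex
        shifts the argument of \<open>conj_f\<close> along \<open>ell j - mix q\<close>.\<close>
      define q' where "q' = (1 - s) *\<^sub>R q + s *\<^sub>R axis j 1"
      have q': "q' \<in> prob_simplex"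
        unfolding q'_def using q axis_in_prob_simplex s by (intro convexD[OF convex_prob_simplex]) auto
      have "mix (axis j 1) = (\<Sum>i\<in>UNIV. if i = j then ell i else 0)"
        unfolding mix_def by (intro sum.cong) (auto simp: axis_def)
      then have "mix (axis j 1) = ell j"
        by simp
      moreover have "mix q' = (1 - s) *\<^sub>R mix q + s *\<^sub>R mix (axis j 1)"
        by (simp add: mix_def q'_def scaleR_add_left sum.distrib scaleR_sum_right)
      ultimately have "mix q' = mix q + s *\<^sub>R (ell j - mix q)"
        by (simp add: algebra_simps)
      then show "conj_f ?\<nu> \<le> conj_f (?\<nu> + s *\<^sub>R (ell j - mix q))"
        using opt[OF q'] by (simp add: add.assoc)
    qed simp
    then show "- (- (mix q \<bullet> m)) \<le> m \<bullet> ell j"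
      by (simp add: inner_diff_left inner_diff_right inner_commute)
  qed
  have lower: "conj_f ?\<nu> + (\<theta>' - \<theta>) \<bullet> m \<le> g \<theta>'" for \<theta>'
  proof (rule LIMSEQ_le_const2)
    let ?R = "\<Sum>j\<in>UNIV. norm (ell j)"
    \<comment> \<open>The value of \<open>f\<close> at \<open>m\<close> is not controlled, so the
      supremum is tested at \<open>X n\<close>. There \<open>tau\<close> is replaced by its upper
      bound from \<open>tau_m\<close> and the Lipschitz estimate, whose error vanishes in the
      limit.\<close>
    let ?h = "\<lambda>n. (?\<nu> \<bullet> X n - f (X n)) + (\<theta>' - ?\<nu>) \<bullet> X n + mix q \<bullet> m - ?R * norm (X n - m)"
    have "?h \<longlonglongrightarrow> conj_f ?\<nu> + (\<theta>' - ?\<nu>) \<bullet> m + mix q \<bullet> m - ?R * norm (m - m)"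
      by (intro tendsto_intros X)
    then show "?h \<longlonglongrightarrow> conj_f ?\<nu> + (\<theta>' - \<theta>) \<bullet> m"
      by (simp add: inner_diff_left inner_add_left)
    have "?h n \<le> g \<theta>'" for n
    proof -
      have "\<theta>' \<bullet> X n - real_of_ereal (?\<Omega>\<tau> (X n)) \<le> g \<theta>'"
        using g_le_iff[of \<theta>' "g \<theta>'"] X(1) by blast
      then show ?thesis
        using tau_le_lipschitz[of ell "X n" m] tau_m X(1)
        by (simp add: f' inner_diff_left)
    qed
    then show "\<exists>N. \<forall>n\<ge>N. ?h n \<le> g \<theta>'"
      by blast
  qed
  have eq: "g \<theta> = conj_f ?\<nu>"
    using lower[of \<theta>] g_upper[of \<theta>] by simp
  show ?thesis
  proof (rule that[OF eq g])
    show "g \<theta> + (\<theta>' - \<theta>) \<bullet> m \<le> g \<theta>'" for \<theta>'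
      using lower eq by simp
    show "g \<theta>' \<le> g \<theta> + (\<theta>' - \<theta>) \<bullet> m + (norm (\<theta>' - \<theta>))\<^sup>2 / (2 * lam)" for \<theta>'
      using g_upper[of \<theta>'] conj_f_upper_quadratic[OF growth, where \<theta>'="\<theta>' + mix q"] eq by simp
    show "lam / 2 * (norm (\<mu> - m))\<^sup>2 \<le> conj_f ?\<nu> + f \<mu> - ?\<nu> \<bullet> \<mu>" if "\<mu> \<in> ?C" for \<mu>
      using growth[OF that] by simp
  qed
qed

end


section \<open>Gradients and rank-one matrices\<close>

lemma gradient_eqI:
  assumes "GDERIV f x :> g"
  shows "gradient f x = g"
  unfolding gradient_def
proof (rule the_equality[where P="\<lambda>g. GDERIV f x :> g", OF assms])
  fix g' assume "GDERIV f x :> g'"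
  then have "(\<lambda>h. h \<bullet> g') = (\<lambda>h. h \<bullet> g)"
    using assms unfolding gderiv_def by (rule has_derivative_unique)
  then have "(g' - g) \<bullet> g' = (g' - g) \<bullet> g"
    by metis
  then have "(g' - g) \<bullet> (g' - g) = 0"
    by (simp add: inner_diff_right)
  then show "g' = g"
    by simp
qed

text \<open>The remainder of the affine approximation is squeezed between 0 and a quadratic.\<close>

lemma GDERIV_of_quadratic_bounds:
  assumes lower: "\<And>z. f x + (z - x) \<bullet> g \<le> f z"
    and upper: "\<And>z. f z \<le> f x + (z - x) \<bullet> g + K * (norm (z - x))\<^sup>2"
  shows "GDERIV f x :> g"
  unfolding gderiv_def has_derivative_at
proof
  show "bounded_linear (\<lambda>h. h \<bullet> g)"
    by (rule bounded_linear_inner_left)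
  show "(\<lambda>h. norm (f (x + h) - f x - h \<bullet> g) / norm h) \<midarrow>0\<rightarrow> 0"
  proof (rule tendsto_sandwich)
    show "\<forall>\<^sub>F h in at 0. 0 \<le> norm (f (x + h) - f x - h \<bullet> g) / norm h"
      by simp
    have "norm (f (x + h) - f x - h \<bullet> g) / norm h \<le> K * norm h" if "h \<noteq> 0" for h
      using lower[of "x + h"] upper[of "x + h"] that
      by (simp add: divide_le_eq power2_eq_square mult.assoc)
    then show "\<forall>\<^sub>F h in at 0. norm (f (x + h) - f x - h \<bullet> g) / norm h \<le> K * norm h"
      by (auto simp: eventually_at_filter)
    show "((\<lambda>h. K * norm h) \<longlongrightarrow> 0) (at 0)"
      by (intro tendsto_mult_right_zero tendsto_norm_zero tendsto_ident_at)
  qed simp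
qed

text \<open>The outer product with \<open>x\<close> is the adjoint of evaluating a matrix at
  \<open>x\<close>; this carries gradients and subgradient inequalities from score vectors to
  matrices.\<close>

lemma inner_outer_product: "V \<bullet> outer_product g x = (V *v x) \<bullet> g"
  by (simp add: inner_vec_def outer_product_def matrix_vector_mult_def sum_distrib_left
      sum_distrib_right mult.commute mult.left_commute)

lemma norm_outer_product: "norm (outer_product g x) = norm g * norm x"
proof -
  have "outer_product g x *v x = (norm x)\<^sup>2 *\<^sub>R g"
    by (simp add: vec_eq_iff outer_product_def matrix_vector_mult_def power2_norm_eq_inner
        inner_vec_def sum_distrib_left sum_distrib_right mult.commute mult.left_commute)
  then have "(norm (outer_product g x))\<^sup>2 = (norm g * norm x)\<^sup>2"
    by (simp add: power2_norm_eq_inner inner_outer_product power_mult_distrib)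
  then show ?thesis
    by simp
qed

lemma GDERIV_matrix_vector_mult:
  fixes \<phi> :: "real ^ 'd::finite \<Rightarrow> real" and V :: "real ^ 'm::finite ^ 'd"
  assumes "GDERIV \<phi> (V *v x) :> g"
  shows "GDERIV (\<lambda>V. \<phi> (V *v x)) V :> outer_product g x"
proof -
  have "linear (\<lambda>V :: real ^ 'm ^ 'd. V *v x)"
    by (rule linearI) (simp_all add: matrix_vector_mult_add_rdistrib scaleR_matrix_vector_assoc)
  then have "((\<lambda>V. V *v x) has_derivative (\<lambda>V. V *v x)) (at V)"
    by (intro bounded_linear_imp_has_derivative linear_conv_bounded_linear[THEN iffD1])
  from has_derivative_compose[OF this] assms show ?thesis
    by (simp add: gderiv_def inner_outer_product)
qed

section \<open>The surrogate loss at a fixed score vector\<close>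

text \<open>With \<open>G = m - \<rho> y\<close>, the terms \<open>c y\<close> in the surrogate and
  in the expected loss cancel. What remains is the Fenchel-Young gap of \<Omega> at the shifted
  score, which grows quadratically around \<open>m\<close>.\<close>

lemma conv_fy_loss_at_minimiser:
  fixes \<rho> :: "'y::finite \<Rightarrow> real ^ 'd::finite" and ell :: "'p::finite \<Rightarrow> real ^ 'd"
    and loss :: "'p \<Rightarrow> 'y \<Rightarrow> real"
  assumes P: "strongly_convex_polytope \<Omega> (range \<rho>) lam"
    and decomp: "\<And>p. loss p y = \<rho> y \<bullet> ell p + c y"
    and min: "(MIN p. loss p y) = 0"
    and argmin: "is_arg_min (\<lambda>q. conjugate \<Omega> (\<theta> + loss_matrix ell *v q)) (\<lambda>q. q \<in> prob_simplex) q"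
  obtains G where "GDERIV (\<lambda>\<theta>'. conv_fy_loss ell \<Omega> \<rho> \<theta>' y) \<theta> :> G"
    and "\<And>\<theta>'. conv_fy_loss ell \<Omega> \<rho> \<theta> y + (\<theta>' - \<theta>) \<bullet> G \<le> conv_fy_loss ell \<Omega> \<rho> \<theta>' y"
    and "lam / 2 * (norm G)\<^sup>2
      \<le> conv_fy_loss ell \<Omega> \<rho> \<theta> y - simplex_expectation q (\<lambda>p. loss p y)"
proof -
  interpret strongly_convex_polytope \<Omega> "range \<rho>" lam
    by (rule P)
  let ?mix = "\<lambda>q :: real ^ 'p. \<Sum>j\<in>UNIV. (q $ j) *\<^sub>R ell j"
  let ?g = "\<lambda>\<theta>. real_of_ereal (conjugate (Omega_tau ell \<Omega>) \<theta>)"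
  have q: "q \<in> prob_simplex"
    and opt: "\<And>q'. q' \<in> prob_simplex \<Longrightarrow> conj_f (\<theta> + ?mix q) \<le> conj_f (\<theta> + ?mix q')"
    using argmin by (auto simp: is_arg_min_linorder conjugate_eq loss_matrix_mult)
  obtain m where m: "?g \<theta> = conj_f (\<theta> + ?mix q)"
      "\<And>\<theta>'. conjugate (Omega_tau ell \<Omega>) \<theta>' = ereal (?g \<theta>')"
      "\<And>\<theta>'. ?g \<theta> + (\<theta>' - \<theta>) \<bullet> m \<le> ?g \<theta>'"
      "\<And>\<theta>'. ?g \<theta>' \<le> ?g \<theta> + (\<theta>' - \<theta>) \<bullet> m + (norm (\<theta>' - \<theta>))\<^sup>2 / (2 * lam)"
      "\<And>\<mu>. \<mu> \<in> convex hull (range \<rho>) \<Longrightarrow> lam / 2 * (norm (\<mu> - m))\<^sup>2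
        \<le> conj_f (\<theta> + ?mix q) + f \<mu> - (\<theta> + ?mix q) \<bullet> \<mu>"
    using infimal_convolution[OF q opt] by blast
  have \<rho>: "\<rho> y \<in> convex hull (range \<rho>)"
    by (simp add: hull_inc)
  \<comment> \<open>A prediction of zero loss gives one inequality of
    \<open>tau ell (\<rho> y) = c y\<close>, nonnegativity of the loss the other.\<close>
  have "(MIN p. loss p y) \<in> range (\<lambda>p. loss p y)"
    by (intro Min_in) auto
  then obtain p where "loss p y = 0"
    using min by auto
  then have "c y \<le> tau ell (\<rho> y)"
    using tau_ge[of "\<rho> y" ell p] decomp[of p] by simp
  moreover have "0 \<le> loss j y" for j
    using Min_le[of "range (\<lambda>p. loss p y)" "loss j y"] min by simp
  then have "tau ell (\<rho> y) \<le> c y"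
    unfolding tau_le_iff using decomp by (metis add.inverse_inverse diff_ge_0_iff_ge diff_minus_eq_add)
  ultimately have tau: "tau ell (\<rho> y) = c y"
    by simp
  have loss_eq: "conv_fy_loss ell \<Omega> \<rho> \<theta>' y = ?g \<theta>' + (f (\<rho> y) + c y) - \<theta>' \<bullet> \<rho> y" for \<theta>'
  proof -
    obtain r where "conjugate (Omega_tau ell \<Omega>) \<theta>' = ereal r"
      using m(2) by blast
    then show ?thesis
      by (simp add: conv_fy_loss_def Omega_tau_def[of _ _ "\<rho> y"] \<Omega>_eq[OF \<rho>] tau)
  qed
  have "simplex_expectation q (\<lambda>p. loss p y) = (\<Sum>j\<in>UNIV. q $ j * (ell j \<bullet> \<rho> y))
      + (\<Sum>j\<in>UNIV. q $ j) * c y"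
    by (simp add: simplex_expectation_eq[OF q] decomp distrib_left sum.distrib sum_distrib_right
        inner_commute)
  then have expectation: "simplex_expectation q (\<lambda>p. loss p y) = ?mix q \<bullet> \<rho> y + c y"
    using q by (simp add: inner_sum_left prob_simplex_def)
  show ?thesis
  proof (rule that)
    show lower: "conv_fy_loss ell \<Omega> \<rho> \<theta> y + (\<theta>' - \<theta>) \<bullet> (m - \<rho> y) \<le> conv_fy_loss ell \<Omega> \<rho> \<theta>' y"
      for \<theta>'
      using m(3)[of \<theta>'] by (simp add: loss_eq inner_diff_left inner_diff_right)
    show "GDERIV (\<lambda>\<theta>'. conv_fy_loss ell \<Omega> \<rho> \<theta>' y) \<theta> :> m - \<rho> y"
    proof (rule GDERIV_of_quadratic_bounds[OF lower])
      show "conv_fy_loss ell \<Omega> \<rho> \<theta>' y \<le> conv_fy_loss ell \<Omega> \<rho> \<theta> y + (\<theta>' - \<theta>) \<bullet> (m - \<rho> y)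
          + 1 / (2 * lam) * (norm (\<theta>' - \<theta>))\<^sup>2" for \<theta>'
        using m(4)[of \<theta>'] by (simp add: loss_eq inner_diff_left inner_diff_right)
    qed
    show "lam / 2 * (norm (m - \<rho> y))\<^sup>2
        \<le> conv_fy_loss ell \<Omega> \<rho> \<theta> y - simplex_expectation q (\<lambda>p. loss p y)"
      using m(1) m(5)[OF \<rho>]
      by (simp add: loss_eq expectation inner_add_left norm_minus_commute)
  qed
qed

section \<open>Dynamic regret of projected online gradient descent\<close>

text \<open>The angle at a projection onto a convex set is obtuse, so projecting does not increase
  the distance to \<open>u\<close>; expand the square of the unprojected distance.\<close>

lemma projected_step:
  fixes w u g w' :: "'a::euclidean_space"
  assumes "closed A" "convex A" "u \<in> A" and "h > 0"
    and w': "is_arg_min (\<lambda>V. norm (w - h *\<^sub>R g - V)) (\<lambda>V. V \<in> A) w'"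
  shows "g \<bullet> (w - u) \<le> ((norm (w - u))\<^sup>2 - (norm (w' - u))\<^sup>2) / (2 * h) + h / 2 * (norm g)\<^sup>2"
proof -
  let ?a = "w - h *\<^sub>R g"
  have "(?a - w') \<bullet> (u - w') \<le> 0"
    using assms by (intro any_closest_point_dot[of A])
      (auto simp: is_arg_min_linorder dist_norm)
  then have "(norm (w' - u))\<^sup>2 \<le> (norm (?a - u))\<^sup>2 - (norm (?a - w'))\<^sup>2"
    by (simp add: power2_norm_eq_inner inner_diff_left inner_diff_right inner_commute algebra_simps)
  also have "\<dots> \<le> (norm (?a - u))\<^sup>2"
    by simp
  also have "\<dots> = (norm (w - u))\<^sup>2 - 2 * h * (g \<bullet> (w - u)) + h * h * (norm g)\<^sup>2"
    by (simp add: power2_norm_eq_inner inner_diff_left inner_diff_right inner_commute algebra_simps)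
  finally show ?thesis
    using \<open>h > 0\<close> by (simp add: field_simps power2_eq_square)
qed

text \<open>The premise \<open>surrogate\<close> absorbs the squared gradients of the one-step
  bounds. The remaining distances telescope, up to the motion of the comparator and the change of
  step size.\<close>

lemma online_gradient_descent_dynamic_regret:
  fixes W U G :: "nat \<Rightarrow> 'a::euclidean_space" and e lW lU \<eta> :: "nat \<Rightarrow> real"
  assumes A: "closed A" "convex A"
    and diam: "\<And>V V'. V \<in> A \<Longrightarrow> V' \<in> A \<Longrightarrow> norm (V - V') \<le> D"
    and "0 < lam" "0 \<le> D"
    and W: "\<And>t. t \<in> {1..T} \<Longrightarrow> W t \<in> A" and U: "\<And>t. t \<in> {1..T} \<Longrightarrow> U t \<in> A"
    and step: "\<And>t. t \<in> {1..<T} \<Longrightarrow>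
      is_arg_min (\<lambda>V. norm (W t - \<eta> t *\<^sub>R G t - V)) (\<lambda>V. V \<in> A) (W (Suc t))"
    and mono: "\<And>s t. s \<in> {1..T} \<Longrightarrow> t \<in> {1..T} \<Longrightarrow> s \<le> t \<Longrightarrow> \<eta> t \<le> \<eta> s"
    and eta: "\<And>t. t \<in> {1..T} \<Longrightarrow> lam \<le> \<eta> t"
    and subgrad: "\<And>t. t \<in> {1..T} \<Longrightarrow> lW t - lU t \<le> G t \<bullet> (W t - U t)"
    and surrogate: "\<And>t. t \<in> {1..T} \<Longrightarrow> \<eta> t / 2 * (norm (G t))\<^sup>2 \<le> lW t - e t"
  shows "(\<Sum>t=1..T. e t)
    \<le> (\<Sum>t=1..T. lU t) + D / lam * (D / 2 + (\<Sum>t=2..T. norm (U t - U (t - 1))))"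
proof -
  define a where "a t = (norm (W t - U t))\<^sup>2" for t
  \<comment> \<open>Distance after the update to the old comparator. No update follows round
    \<open>T\<close>, hence the value 0 there.\<close>
  define r where "r t = (if t < T then (norm (W (Suc t) - U t))\<^sup>2 else 0)" for t
  define \<Delta> where "\<Delta> t = norm (U t - U (t - 1))" for t
  have pos: "0 < \<eta> t" if "t \<in> {1..T}" for t
    using eta[OF that] \<open>0 < lam\<close> by simp
  have a_le: "a t \<le> D\<^sup>2" if "t \<in> {1..T}" for t
    unfolding a_def using that by (intro power_mono diam W U) auto
  have one_step: "e t - lU t \<le> (a t - r t) / (2 * \<eta> t)" if t: "t \<in> {1..T}" for t
  proof -
    have "G t \<bullet> (W t - U t) \<le> (a t - r t) / (2 * \<eta> t) + \<eta> t / 2 * (norm (G t))\<^sup>2"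
    proof (cases "t < T")
      case True
      then show ?thesis
        using projected_step[OF A U[OF t] pos[OF t] step] t by (simp add: a_def r_def)
    next
      case False
      \<comment> \<open>In the last round a nonnegative square replaces the projection
        argument.\<close>
      have "0 \<le> (norm (W t - U t - \<eta> t *\<^sub>R G t))\<^sup>2 / (2 * \<eta> t)"
        using pos[OF t] by simp
      also have "(norm (W t - U t - \<eta> t *\<^sub>R G t))\<^sup>2
          = a t - 2 * \<eta> t * (G t \<bullet> (W t - U t)) + \<eta> t * \<eta> t * (norm (G t))\<^sup>2"
        by (simp add: a_def power2_norm_eq_inner inner_diff_left inner_diff_right inner_commute
            algebra_simps)
      also have "\<dots> / (2 * \<eta> t)
          = a t / (2 * \<eta> t) + \<eta> t / 2 * (norm (G t))\<^sup>2 - G t \<bullet> (W t - U t)"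
        using pos[OF t] by (simp add: field_simps)
      finally show ?thesis
        using False by (simp add: r_def)
    qed
    then show ?thesis
      using subgrad[OF t] surrogate[OF t] by simp
  qed
  have drift: "(a (Suc t) - r t) / (2 * \<eta> t) \<le> D / lam * \<Delta> (Suc t)"
    if t: "t \<in> {1..T}" "Suc t \<in> {1..T}" for t
  proof -
    let ?a = "norm (W (Suc t) - U (Suc t))" and ?b = "norm (W (Suc t) - U t)"
    have Suc: "\<Delta> (Suc t) = norm (U (Suc t) - U t)"
      by (simp add: \<Delta>_def)
    have b: "?b \<le> D" and a: "?a \<le> D"
      using t by (intro diam W U; simp)+
    have "?a - ?b \<le> \<Delta> (Suc t)"
      using norm_triangle_ineq2[of "W (Suc t) - U (Suc t)" "W (Suc t) - U t"]
      by (simp add: Suc norm_minus_commute)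
    moreover have "0 \<le> \<Delta> (Suc t)"
      by (simp add: Suc)
    \<comment> \<open>The first factor may be negative; nonnegativity of its bound is what permits
      multiplying the two estimates.\<close>
    ultimately have "(?a - ?b) * (?a + ?b) \<le> \<Delta> (Suc t) * (2 * D)"
      using a b \<open>0 \<le> D\<close> by (intro mult_mono) auto
    moreover have "a (Suc t) - r t = (?a - ?b) * (?a + ?b)"
      using t by (simp add: a_def r_def power2_eq_square algebra_simps)
    ultimately have "(a (Suc t) - r t) / (2 * \<eta> t) \<le> (\<Delta> (Suc t) * (2 * D)) / (2 * \<eta> t)"
      using pos[OF t(1)] by (intro divide_right_mono) auto
    also have "\<dots> = (\<Delta> (Suc t) * D) / \<eta> t"
      by simp
    also have "\<dots> \<le> (\<Delta> (Suc t) * D) / lam"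
      using eta[OF t(1)] \<open>0 < lam\<close> \<open>0 \<le> D\<close> by (intro divide_left_mono) (auto simp: Suc)
    finally show ?thesis
      by (simp add: mult.commute)
  qed
  \<comment> \<open>Keeping \<open>D\<^sup>2 - r n\<close> over the current step size makes the
    induction close: \<open>D\<^sup>2 - a (Suc n)\<close> is nonnegative, so passing to the smaller
    step size only enlarges the bound.\<close>
  have bound: "(\<Sum>t=1..n. e t) - (\<Sum>t=1..n. lU t)
      \<le> (D\<^sup>2 - r n) / (2 * \<eta> n) + D / lam * (\<Sum>t=2..n. \<Delta> t)" if "1 \<le> n" "n \<le> T" for n
    using that
  proof (induction n rule: dec_induct)
    case base
    have "(a 1 - r 1) / (2 * \<eta> 1) \<le> (D\<^sup>2 - r 1) / (2 * \<eta> 1)"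
      using a_le[of 1] pos[of 1] base by (intro divide_right_mono) auto
    then show ?case
      using one_step[of 1] base by simp
  next
    case (step n)
    then have n: "n \<in> {1..T}" "Suc n \<in> {1..T}"
      by auto
    have "1 / (2 * \<eta> n) \<le> 1 / (2 * \<eta> (Suc n))"
      using mono[OF n] pos[OF n(2)] by (simp add: frac_le)
    then have "(D\<^sup>2 - a (Suc n)) * (1 / (2 * \<eta> n)) \<le> (D\<^sup>2 - a (Suc n)) * (1 / (2 * \<eta> (Suc n)))"
      using a_le[OF n(2)] by (intro mult_left_mono) auto
    then have "(D\<^sup>2 - r n) / (2 * \<eta> n) + (a (Suc n) - r (Suc n)) / (2 * \<eta> (Suc n))
        \<le> (D\<^sup>2 - r (Suc n)) / (2 * \<eta> (Suc n)) + (a (Suc n) - r n) / (2 * \<eta> n)"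
      by (simp add: diff_divide_distrib)
    moreover have "(\<Sum>t=2..Suc n. \<Delta> t) = (\<Sum>t=2..n. \<Delta> t) + \<Delta> (Suc n)"
      using step by simp
    ultimately show ?case
      using step n one_step[OF n(2)] drift[OF n] by (simp add: distrib_left)
  qed
  have "(\<Sum>t=1..T. e t) - (\<Sum>t=1..T. lU t) \<le> D\<^sup>2 / (2 * lam) + D / lam * (\<Sum>t=2..T. \<Delta> t)"
  \<comment> \<open>For \<open>T = 0\<close> the sums are empty and the bound is nonnegative;
    otherwise \<open>r T = 0\<close> leaves \<open>D\<^sup>2\<close> over
    \<open>2 * \<eta> T\<close>.\<close>
  proof (cases "T = 0")
    case False
    then have T: "T \<in> {1..T}"
      by simp
    have "D\<^sup>2 / (2 * \<eta> T) \<le> D\<^sup>2 / (2 * lam)"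
      using eta[OF T] \<open>0 < lam\<close> by (simp add: frac_le)
    then show ?thesis
      using bound[of T] False by (simp add: r_def)
  qed (use \<open>0 < lam\<close> in simp)
  then show ?thesis
    by (simp add: \<Delta>_def distrib_left power2_eq_square)
qed

section \<open>Expected target loss under online gradient descent on the surrogate\<close>

text \<open>The gradient formula and the non-emptiness of the step-size range precede the
  implication about learning rates, so they do not presuppose an admissible sequence.\<close>

theorem theorem4p5:
  fixes loss :: "'p::finite \<Rightarrow> 'y::finite \<Rightarrow> real"
    and \<rho> :: "'y \<Rightarrow> real ^ 'd::finite"
    and ell :: "'p \<Rightarrow> real ^ 'd"
    and c :: "'y \<Rightarrow> real"
    and lam D :: real
    and \<Omega> :: "real ^ 'd \<Rightarrow> ereal"
    and \<W> :: "(real ^ 'm::finite ^ 'd) set"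
    and T :: nat
    and x :: "nat \<Rightarrow> real ^ 'm"
    and y :: "nat \<Rightarrow> 'y"
    and \<pi> :: "real ^ 'd \<Rightarrow> real ^ 'p"
    and W :: "nat \<Rightarrow> real ^ 'm ^ 'd"
    and \<eta> :: "nat \<Rightarrow> real"
    and \<theta> :: "nat \<Rightarrow> real ^ 'd"
    and L :: "nat \<Rightarrow> real ^ 'm ^ 'd \<Rightarrow> real"
    and G :: "nat \<Rightarrow> real ^ 'm ^ 'd"
    and E :: "nat \<Rightarrow> real"
  assumes loss_nonneg: "\<And>p y. 0 \<le> loss p y"
    and loss_decomp: "\<And>p y. loss p y = \<rho> y \<bullet> ell p + c y"
    and loss_min: "\<And>y. (MIN p. loss p y) = 0"
    and lam_pos: "lam > 0"
    and Omega_proper: "\<And>\<mu>. \<Omega> \<mu> \<noteq> -\<infinity>"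
    and Omega_dom: "eff_dom \<Omega> = convex hull (range \<rho>)"
    and Omega_strongly_convex: "strongly_convex_on lam (convex hull (range \<rho>)) \<Omega>"
    and x_bound: "\<And>t. t \<in> {1..T} \<Longrightarrow> norm (x t) \<le> 1"
    and W_set: "\<W> \<noteq> {}" "closed \<W>" "convex \<W>"
    and D_pos: "D > 0"
    and D_diam: "\<And>V V'. V \<in> \<W> \<Longrightarrow> V' \<in> \<W> \<Longrightarrow> norm (V - V') \<le> D"
    and theta_def: "\<And>t. \<theta> t = W t *v x t"
    and L_def: "\<And>t V. L t V = conv_fy_loss ell \<Omega> \<rho> (V *v x t) (y t)"
    and G_def: "\<And>t. G t = gradient (L t) (W t)"
    and E_def: "\<And>t. E t = simplex_expectation (\<pi> (\<theta> t)) (\<lambda>p. loss p (y t))"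
    and pi_argmin: "\<And>t. t \<in> {1..T} \<Longrightarrow>
          is_arg_min (\<lambda>q. conjugate \<Omega> (\<theta> t + loss_matrix ell *v q)) (\<lambda>q. q \<in> prob_simplex) (\<pi> (\<theta> t))"
    and W_mem: "\<And>t. t \<in> {1..T} \<Longrightarrow> W t \<in> \<W>"
  shows "(\<forall>t\<in>{1..T}.
            G t = outer_product (gradient (\<lambda>\<theta>'. conv_fy_loss ell \<Omega> \<rho> \<theta>' (y t)) (\<theta> t)) (x t)) \<and>
         (\<forall>t\<in>{1..T}.
            {h::real. lam \<le> h \<and> (G t \<noteq> 0 \<longrightarrow> h \<le> 2 * (L t (W t) - E t) / (norm (G t))\<^sup>2)} \<noteq> {}) \<and>
         ((\<forall>t\<in>{1..<T}.
             is_arg_min (\<lambda>V. norm (W t - \<eta> t *\<^sub>R G t - V)) (\<lambda>V. V \<in> \<W>) (W (Suc t))) \<and>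
          (\<forall>s\<in>{1..T}. \<forall>t\<in>{1..T}. s \<le> t \<longrightarrow> \<eta> t \<le> \<eta> s) \<and>
          (\<forall>t\<in>{1..T}. lam \<le> \<eta> t \<and>
             (G t \<noteq> 0 \<longrightarrow> \<eta> t \<le> 2 * (L t (W t) - E t) / (norm (G t))\<^sup>2))
          \<longrightarrow> (\<forall>U. (\<forall>t\<in>{1..T}. U t \<in> \<W>) \<longrightarrow>
                 (\<Sum>t=1..T. E t)
                   \<le> (\<Sum>t=1..T. L t (U t))
                      + D / lam * (D / 2 + (\<Sum>t=2..T. norm (U t - U (t - 1))))))"
proof -
  have P: "strongly_convex_polytope \<Omega> (range \<rho>) lam"
    using Omega_proper Omega_dom lam_pos Omega_strongly_convex by unfold_locales auto
  have "\<exists>g. GDERIV (\<lambda>\<theta>'. conv_fy_loss ell \<Omega> \<rho> \<theta>' (y t)) (\<theta> t) :> g \<and>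
      (\<forall>\<theta>'. conv_fy_loss ell \<Omega> \<rho> (\<theta> t) (y t) + (\<theta>' - \<theta> t) \<bullet> g \<le> conv_fy_loss ell \<Omega> \<rho> \<theta>' (y t)) \<and>
      lam / 2 * (norm g)\<^sup>2 \<le> conv_fy_loss ell \<Omega> \<rho> (\<theta> t) (y t) - E t" if "t \<in> {1..T}" for t
    using conv_fy_loss_at_minimiser[where loss=loss and y="y t" and c=c,
        OF P loss_decomp loss_min pi_argmin[OF that]]
    unfolding E_def by blast
  then obtain g where g: "\<And>t. t \<in> {1..T} \<Longrightarrow>
        GDERIV (\<lambda>\<theta>'. conv_fy_loss ell \<Omega> \<rho> \<theta>' (y t)) (\<theta> t) :> g t"
      "\<And>t \<theta>'. t \<in> {1..T} \<Longrightarrow> conv_fy_loss ell \<Omega> \<rho> (\<theta> t) (y t) + (\<theta>' - \<theta> t) \<bullet> g t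
        \<le> conv_fy_loss ell \<Omega> \<rho> \<theta>' (y t)"
      "\<And>t. t \<in> {1..T} \<Longrightarrow> lam / 2 * (norm (g t))\<^sup>2 \<le> conv_fy_loss ell \<Omega> \<rho> (\<theta> t) (y t) - E t"
    by metis
  have LW: "L t (W t) = conv_fy_loss ell \<Omega> \<rho> (\<theta> t) (y t)" for t
    by (simp add: L_def theta_def)
  have G: "G t = outer_product (g t) (x t)" if t: "t \<in> {1..T}" for t
  proof -
    have "GDERIV (L t) (W t) :> outer_product (g t) (x t)"
      using GDERIV_matrix_vector_mult[OF g(1)[OF t, unfolded theta_def]] by (simp flip: L_def)
    then show ?thesis
      by (simp add: G_def gradient_eqI)
  qed
  \<comment> \<open>Inputs of norm at most 1 ensure that passing from the score gradient to the
    matrix gradient does not increase the norm.\<close>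
  have excess: "lam / 2 * (norm (G t))\<^sup>2 \<le> L t (W t) - E t" if t: "t \<in> {1..T}" for t
  proof -
    have "norm (G t) \<le> norm (g t)"
      using mult_left_mono[OF x_bound[OF t], of "norm (g t)"] by (simp add: G[OF t] norm_outer_product)
    then have "lam / 2 * (norm (G t))\<^sup>2 \<le> lam / 2 * (norm (g t))\<^sup>2"
      using lam_pos by (intro mult_left_mono power_mono) auto
    then show ?thesis
      using g(3)[OF t] by (simp add: LW)
  qed
  have subgrad: "L t (W t) - L t V \<le> G t \<bullet> (W t - V)" if t: "t \<in> {1..T}" for t V
  proof -
    have "(V - W t) \<bullet> G t = (V *v x t - \<theta> t) \<bullet> g t"
      by (simp add: G[OF t] inner_outer_product theta_def matrix_vector_mult_diff_rdistrib)
    then have "L t (W t) + (V - W t) \<bullet> G t \<le> L t V"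
      using g(2)[OF t, of "V *v x t"] by (simp add: LW) (simp add: L_def)
    then show ?thesis
      by (simp add: inner_diff_left inner_diff_right inner_commute)
  qed
  show ?thesis
  proof (intro conjI impI ballI allI)
    fix t assume t: "t \<in> {1..T}"
    show "G t = outer_product (gradient (\<lambda>\<theta>'. conv_fy_loss ell \<Omega> \<rho> \<theta>' (y t)) (\<theta> t)) (x t)"
      by (simp add: G[OF t] gradient_eqI[OF g(1)[OF t]])
    have "lam \<in> {h. lam \<le> h \<and> (G t \<noteq> 0 \<longrightarrow> h \<le> 2 * (L t (W t) - E t) / (norm (G t))\<^sup>2)}"
      using excess[OF t] by (simp add: pos_le_divide_eq)
    then show "{h. lam \<le> h \<and> (G t \<noteq> 0 \<longrightarrow> h \<le> 2 * (L t (W t) - E t) / (norm (G t))\<^sup>2)} \<noteq> {}"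
      by blast
  next
    fix U
    assume H: "(\<forall>t\<in>{1..<T}.
          is_arg_min (\<lambda>V. norm (W t - \<eta> t *\<^sub>R G t - V)) (\<lambda>V. V \<in> \<W>) (W (Suc t))) \<and>
        (\<forall>s\<in>{1..T}. \<forall>t\<in>{1..T}. s \<le> t \<longrightarrow> \<eta> t \<le> \<eta> s) \<and>
        (\<forall>t\<in>{1..T}. lam \<le> \<eta> t \<and>
          (G t \<noteq> 0 \<longrightarrow> \<eta> t \<le> 2 * (L t (W t) - E t) / (norm (G t))\<^sup>2))"
      and U: "\<forall>t\<in>{1..T}. U t \<in> \<W>"
    show "(\<Sum>t=1..T. E t)
      \<le> (\<Sum>t=1..T. L t (U t)) + D / lam * (D / 2 + (\<Sum>t=2..T. norm (U t - U (t - 1))))"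
    proof (rule online_gradient_descent_dynamic_regret[OF W_set(2,3) D_diam lam_pos
          less_imp_le[OF D_pos] W_mem])
      fix t assume t: "t \<in> {1..T}"
      show "\<eta> t / 2 * (norm (G t))\<^sup>2 \<le> L t (W t) - E t"
      \<comment> \<open>With a zero gradient the upper bound on the step size is void; the claim
        then only says that the expected loss is at most the surrogate, which \<open>excess\<close>
        provides.\<close>
      proof (cases "G t = 0")
        case True
        then show ?thesis
          using excess[OF t] by simp
      next
        case False
        then have "\<eta> t \<le> 2 * (L t (W t) - E t) / (norm (G t))\<^sup>2"
          using H t by blast
        then show ?thesis
          using False by (simp add: pos_le_divide_eq)
      qed
    qed (use H U subgrad in auto)
  qed
qed

end
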